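(* Let $P$ be a $d$-polytope with the $V(P)$-pointed triangulation $\mathcal{C}_P$, and let $P(n)$ and $P(n)^\sharp$ be the $V(P)$-polytope numbers and interior polytope numbers. Then for all $n\ge0$ $$P(n)=\bigg|\bigcup_{\alpha^d\in\mathcal{F}_d(\mathcal{C}_P)}S_{\alpha^d}(n)\bigg|,$$ $$P(n)^\sharp=\Bigg|\bigg(\bigcup_{\alpha^d\in\mathcal{F}_d(\mathcal{C}_P)}S_{\alpha^d}(n)\bigg)\setminus\bigg(\bigcup_{\alpha^{d-1}\in\mathcal{F}_{d-1}(\mathcal{C}_P),\ \alpha^{d-1}\subseteq\partial P}S_{\alpha^{d-1}}(n)\bigg)\Bigg|.$$
   Context: A $d$-polytope is a $d$-dimensional convex hull of finitely many points in some $\mathbb{R}^e$. $\partial P$ is the union of the proper faces of $P$. $\mathbb{N}=\{0,1,2,\ldots\}$. Pointed triangulation: let $\mathbf{c}\mathbf{x}$ be a linear function taking distinct values at distinct vertexes of $P$. For each nonempty face $F$ of $P$ (including $P$) let the apex $\mathbf{v}_F$ be the unique vertex of $F$ at which $\mathbf{c}\mathbf{x}$ attains its minimum on $F$; $V(P)$ denotes this system of apexes. The $V(P)$-pointed triangulation of $P$ is $$\mathcal{C}_P=\{\emptyset\}\cup\big\{conv(\{\mathbf{v}_{G_1},\ldots,\mathbf{v}_{G_k}\}) : 1\le k\le d+1,\ G_1\supsetneq\cdots\supsetneq G_k \text{ nonempty faces of } P,\ \mathbf{v}_{G_i}\notin G_{i+1}\ (1\le i<k)\big\},$$ which is a triangulation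 of $P$. $\mathcal{F}_k(\mathcal{C}_P)$ is the set of $k$-simplexes of $\mathcal{C}_P$. Polytope numbers: let $\mathcal{F}(P)$ be the set of nonempty faces of $P$, including $P$. With the apexes above, the $V(P)$-polytope numbers $P(n)$ and interior polytope numbers $P(n)^\sharp$ are defined by double induction on $d=\dim P$ and $n\ge0$ (each face is a polytope with the inherited apexes): if $d=0$, $P(0)=P(0)^\sharp=0$ and $P(n)=P(n)^\sharp=1$ for $n\ge1$; if $d\ge1$, $P(0)=0$, $P(1)=1$, $P(0)^\sharp=P(1)^\sharp=0$, and for $n\ge2$ $$P(n)=P(n-1)+\sum_{F\in\mathcal{F}(P),\ \mathbf{v}_P\notin F}F(n)^\sharp,\qquad P(n)^\sharp=P(n)-\sum_{F\in\mathcal{F}(P)\setminus\{P\}}F(n)^\sharp .$$ Point arrangements: for a $k$-simplex $\alpha^k$ ($k\ge0$) with vertexes $\mathbf{w}_1,\ldots,\mathbf{w}_{k+1}$, $$S_{\alpha^k}(n)=\Big\{\sum_{i=1}^{k+1}x_i\mathbf{w}_i : (x_1,\ldots,x_{k+1})\in\mathbb{N}^{k+1},\ \sum_{i=1}^{k+1} x_i=n-1\Big\}.$$ When $d=0$ the union over $(d-1)$-simplexes is empty. *)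

theory Defs
  imports "HOL-Analysis.Analysis"
begin

definition vertices :: "'a::euclidean_space set \<Rightarrow> 'a set" where
  "vertices P = {v. v extreme_point_of P}"

definition nonempty_faces :: "'a::euclidean_space set \<Rightarrow> 'a set set" where
  "nonempty_faces P = {F. F face_of P \<and> F \<noteq> {}}"

definition boundary :: "'a::euclidean_space set \<Rightarrow> 'a set" where
  "boundary P = \<Union>{F. F face_of P \<and> F \<noteq> P}"

text \<open>A linear functional on a Euclidean space is given by the inner product with a vector \<open>c\<close>.\<close>

definition separates_vertices :: "'a::euclidean_space \<Rightarrow> 'a set \<Rightarrow> bool" where
  "separates_vertices c P \<longleftrightarrow> inj_on (\<lambda>x. c \<bullet> x) (vertices P)"

definition apex :: "'a::euclidean_space \<Rightarrow> 'a set \<Rightarrow> 'a" where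
  "apex c F = (THE v. v \<in> vertices F \<and> (\<forall>x\<in>F. c \<bullet> v \<le> c \<bullet> x))"

definition apex_chain :: "'a::euclidean_space \<Rightarrow> 'a set \<Rightarrow> 'a set list \<Rightarrow> bool" where
  "apex_chain c P Gs \<longleftrightarrow> set Gs \<subseteq> nonempty_faces P \<and>
     (\<forall>i. Suc i < length Gs \<longrightarrow> Gs ! Suc i \<subset> Gs ! i \<and> apex c (Gs ! i) \<notin> Gs ! Suc i)"

definition pointed_triangulation :: "'a::euclidean_space \<Rightarrow> 'a set \<Rightarrow> 'a set set" where
  "pointed_triangulation c P =
     {{}} \<union> {convex hull (apex c ` set Gs) | Gs.
        1 \<le> length Gs \<and> int (length Gs) \<le> aff_dim P + 1 \<and> apex_chain c P Gs}"

text \<open>The dimension is an integer so that \<open>d - 1\<close> makes sense for \<open>d = 0\<close>.  The empty simplex,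
  which has dimension \<open>-1\<close>, is excluded: no point arrangement is attached to it, and
  the union over \<open>(d - 1)\<close>-simplexes has to be empty for \<open>d = 0\<close>.\<close>

definition simplexes_of_dim :: "int \<Rightarrow> 'a::euclidean_space set set \<Rightarrow> 'a set set" where
  "simplexes_of_dim k C = {\<alpha> \<in> C. 0 \<le> k \<and> k simplex \<alpha>}"

text \<open>The condition that the coefficients sum to \<open>n - 1\<close> is written without
  truncated subtraction, so the arrangement is empty for \<open>n = 0\<close>.\<close>

definition point_arrangement :: "'a::euclidean_space set \<Rightarrow> nat \<Rightarrow> 'a set" where
  "point_arrangement \<alpha> n =
     {\<Sum>w\<in>vertices \<alpha>. real (x w) *\<^sub>R w | x :: 'a \<Rightarrow> nat. (\<Sum>w\<in>vertices \<alpha>. x w) + 1 = n}"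

lemma apex_in:
  assumes "polytope P" "P \<noteq> {}" "separates_vertices c P"
  shows "apex c P \<in> P"
proof -
  have "compact P" "convex P"
    using assms(1) by (simp_all add: polytope_imp_compact polytope_imp_convex)
  obtain m where m: "m \<in> P" "\<forall>x\<in>P. c \<bullet> m \<le> c \<bullet> x"
    using continuous_attains_inf[OF \<open>compact P\<close> \<open>P \<noteq> {}\<close>, of "\<lambda>x. c \<bullet> x"]
      continuous_on_inner[OF continuous_on_const continuous_on_id, of P c] by auto
  let ?F = "P \<inter> {x. c \<bullet> x = c \<bullet> m}"
  have F: "?F face_of P"
    using face_of_Int_supporting_hyperplane_ge[OF \<open>convex P\<close>, of "c \<bullet> m" c] m(2) by auto
  have "compact ?F" "convex ?F"
    using face_of_polytope_polytope[OF assms(1) F]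
    by (simp_all add: polytope_imp_compact polytope_imp_convex)
  then obtain v where v: "v extreme_point_of ?F"
    using extreme_point_exists_convex[of ?F] m(1) by auto
  have vP: "v extreme_point_of P" using v F extreme_point_of_face by blast
  have "c \<bullet> v = c \<bullet> m" using v by (auto simp: extreme_point_of_def)
  have "apex c P = v"
    unfolding apex_def
  proof (rule the_equality)
    show "v \<in> vertices P \<and> (\<forall>x\<in>P. c \<bullet> v \<le> c \<bullet> x)"
      using vP \<open>c \<bullet> v = c \<bullet> m\<close> m(2) by (simp add: vertices_def)
  next
    fix w assume w: "w \<in> vertices P \<and> (\<forall>x\<in>P. c \<bullet> w \<le> c \<bullet> x)"
    have "w \<in> P" "v \<in> P" using w vP by (auto simp: vertices_def extreme_point_of_def)
    then have "c \<bullet> w = c \<bullet> v"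
      using w \<open>c \<bullet> v = c \<bullet> m\<close> m(2) by (metis order_antisym)
    then show "w = v"
      using assms(3) w vP by (auto simp: separates_vertices_def vertices_def dest: inj_onD)
  qed
  then show ?thesis using vP by (simp add: extreme_point_of_def)
qed

text \<open>The numbers are integers because of the subtraction in the interior numbers.  Arguments
  that are not nonempty polytopes, or whose vertices \<open>c\<close> does not separate, get the irrelevant
  value 0; this makes the recursion total.  Faces inherit the apexes since \<^term>\<open>apex c F\<close> depends on \<open>c\<close> and \<open>F\<close> only.\<close>

function polytope_number :: "'a::euclidean_space \<Rightarrow> 'a set \<Rightarrow> nat \<Rightarrow> int"
  and interior_polytope_number :: "'a \<Rightarrow> 'a set \<Rightarrow> nat \<Rightarrow> int"
where
  "polytope_number c P n =
    (if \<not> (polytope P \<and> P \<noteq> {} \<and> separates_vertices c P) then 0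
     else if aff_dim P = 0 then (if n = 0 then 0 else 1)
     else if n = 0 then 0
     else if n = 1 then 1
     else polytope_number c P (n - 1)
        + (\<Sum>F\<in>{F \<in> nonempty_faces P. apex c P \<notin> F}. interior_polytope_number c F n))"
| "interior_polytope_number c P n =
    (if \<not> (polytope P \<and> P \<noteq> {} \<and> separates_vertices c P) then 0
     else if aff_dim P = 0 then (if n = 0 then 0 else 1)
     else if n = 0 \<or> n = 1 then 0
     else polytope_number c P n
        - (\<Sum>F\<in>nonempty_faces P - {P}. interior_polytope_number c F n))"
  by pat_completeness auto
termination
proof -
  let ?m = "\<lambda>p :: ('a \<times> 'a set \<times> nat) + ('a \<times> 'a set \<times> nat).
    nat (aff_dim (case p of Inl (c, P, n) \<Rightarrow> P | Inr (c, P, n) \<Rightarrow> P) + 1)"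
  let ?n = "\<lambda>p :: ('a \<times> 'a set \<times> nat) + ('a \<times> 'a set \<times> nat).
    case p of Inl (c, P, n) \<Rightarrow> n | Inr (c, P, n) \<Rightarrow> n"
  let ?f = "\<lambda>p :: ('a \<times> 'a set \<times> nat) + ('a \<times> 'a set \<times> nat).
    (case p of Inl _ \<Rightarrow> 0 | Inr _ \<Rightarrow> 1) :: nat"
  have less: "aff_dim F + 1 \<le> aff_dim P" "0 \<le> aff_dim P"
    if "polytope P" "F \<in> nonempty_faces P" "F \<noteq> P" for F P :: "'a set"
  proof -
    show "aff_dim F + 1 \<le> aff_dim P"
      using that face_of_aff_dim_lt[of P F] polytope_imp_convex[of P]
      by (auto simp: nonempty_faces_def)
    moreover have "F \<noteq> {}" using that by (simp add: nonempty_faces_def)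
    then have "0 \<le> aff_dim F" using aff_dim_negative_iff[of F] by linarith
    ultimately show "0 \<le> aff_dim P" by linarith
  qed
  have ne: "F \<noteq> P" if "polytope P" "P \<noteq> {}" "separates_vertices c P" "apex c P \<notin> F"
    for c :: 'a and F P
    using apex_in that by blast
  show ?thesis
    by (relation "measures [?m, ?n, ?f]")
      (simp_all, (metis less ne)+)
qed

declare polytope_number.simps [simp del] interior_polytope_number.simps [simp del]

end

theory Submission
  imports Defs "HOL-Library.Multiset"
begin

text \<open>
  Put \<open>m = n - 1\<close> and let \<open>B\<^sub>P(m)\<close> be the set of all sums of \<open>m\<close> vertices, with repetition, taken
  from the apexes of one chain of faces.  Every chain extends to one of length \<open>d + 1\<close>, and the apexes
  of a chain are affinely independent, so \<open>B\<^sub>P(m)\<close> is the union of the arrangements of the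
  \<open>d\<close>-simplexes.  Intersecting the members of a chain with a face \<open>F\<close> shows \<open>B\<^sub>P(m) \<inter> m F = B\<^sub>F(m)\<close>
  for \<open>m > 0\<close>.  Hence \<open>B\<^sub>P(m)\<close> splits according to the face whose relative interior contains \<open>y / m\<close>,
  which is the recursion for the interior numbers.  Since every chain can be prolonged to one
  starting with \<open>P\<close>, a point of \<open>B\<^sub>P(m + 1)\<close> either lies in \<open>v\<^sub>P + B\<^sub>P(m)\<close> or belongs to a face avoiding
  \<open>v\<^sub>P\<close>; the two cases exclude each other because \<open>v\<^sub>P\<close> enters the first kind of point with positive
  weight, and a face containing such an average contains \<open>v\<^sub>P\<close>.
\<close>

section \<open>Polytopes and faces with inherited apexes\<close>

definition pointed_polytope :: "'a::euclidean_space \<Rightarrow> 'a set \<Rightarrow> bool" where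
  "pointed_polytope c P \<longleftrightarrow> polytope P \<and> P \<noteq> {} \<and> separates_vertices c P"

lemma pointed_polytope_convex: "pointed_polytope c P \<Longrightarrow> convex P"
  by (simp add: pointed_polytope_def polytope_imp_convex)

lemma vertices_face: "F face_of P \<Longrightarrow> vertices F = vertices P \<inter> F"
  by (auto simp: vertices_def extreme_point_of_face)

lemma pointed_polytope_face:
  assumes "pointed_polytope c P" "F \<in> nonempty_faces P"
  shows "pointed_polytope c F"
proof -
  have F: "F face_of P" "F \<noteq> {}"
    using assms(2) by (auto simp: nonempty_faces_def)
  then show ?thesis
    using assms(1) vertices_face[OF F(1)] face_of_polytope_polytope[OF _ F(1)]
    by (auto simp: pointed_polytope_def separates_vertices_def inj_on_def)
qed

lemma pointed_polytope_self_face: "pointed_polytope c P \<Longrightarrow> P \<in> nonempty_faces P"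
  by (auto simp: pointed_polytope_def nonempty_faces_def polytope_imp_convex face_of_refl)

lemma nonempty_faces_subset: "F \<in> nonempty_faces P \<Longrightarrow> F \<subseteq> P"
  by (simp add: nonempty_faces_def face_of_imp_subset)

lemma nonempty_faces_trans:
  "F \<in> nonempty_faces P \<Longrightarrow> G \<in> nonempty_faces F \<Longrightarrow> G \<in> nonempty_faces P"
  by (auto simp: nonempty_faces_def intro: face_of_trans)

lemma finite_nonempty_faces: "pointed_polytope c P \<Longrightarrow> finite (nonempty_faces P)"
  using finite_polytope_faces[of P] by (simp add: nonempty_faces_def pointed_polytope_def)

lemma finite_vertices: "polytope P \<Longrightarrow> finite (vertices P)"
  unfolding vertices_def polytope_def
  using finite_subset[OF extreme_points_of_convex_hull] by blast

section \<open>Existence of apexes and their behaviour on faces\<close>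

lemma apex_eqI:
  assumes "separates_vertices c P" "v \<in> vertices P" "\<And>x. x \<in> P \<Longrightarrow> c \<bullet> v \<le> c \<bullet> x"
  shows "apex c P = v"
  unfolding apex_def
proof (rule the_equality)
  fix w assume w: "w \<in> vertices P \<and> (\<forall>x\<in>P. c \<bullet> w \<le> c \<bullet> x)"
  moreover have "w \<in> P" "v \<in> P"
    using w assms(2) by (auto simp: vertices_def extreme_point_of_def)
  ultimately have "c \<bullet> w = c \<bullet> v"
    using assms(3) by (metis order_antisym)
  then show "w = v"
    using assms w by (auto simp: separates_vertices_def dest: inj_onD)
qed (use assms in auto)

text \<open>A minimum over the finite vertex set exists. By Krein-Milman \<open>P\<close> is the
  hull of its vertices, and a half-space is convex, so the bound passes from the vertices to all of
  \<open>P\<close>.\<close>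

lemma apex_minimal_vertex:
  assumes "pointed_polytope c P"
  shows "apex c P \<in> vertices P" "x \<in> P \<Longrightarrow> c \<bullet> apex c P \<le> c \<bullet> x"
proof -
  have P: "polytope P" "P \<noteq> {}" "separates_vertices c P"
    using assms by (auto simp: pointed_polytope_def)
  have hull: "P = convex hull vertices P"
    unfolding vertices_def
    by (rule Krein_Milman_Minkowski) (use P in \<open>auto simp: polytope_imp_compact polytope_imp_convex\<close>)
  then have "vertices P \<noteq> {}"
    using P by auto
  then obtain v where v: "v \<in> vertices P" "\<And>w. w \<in> vertices P \<Longrightarrow> c \<bullet> v \<le> c \<bullet> w"
    using ex_min_if_finite[of "(\<lambda>x. c \<bullet> x) ` vertices P"] finite_vertices[OF P(1)]
    by (auto simp: not_less)
  have "convex hull vertices P \<subseteq> {x. c \<bullet> x \<ge> c \<bullet> v}"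
    by (rule hull_minimal) (auto simp: v convex_halfspace_ge)
  then have min: "\<And>x. x \<in> P \<Longrightarrow> c \<bullet> v \<le> c \<bullet> x"
    using hull by auto
  have "apex c P = v"
    by (rule apex_eqI[OF P(3) v(1) min])
  then show "apex c P \<in> vertices P" "x \<in> P \<Longrightarrow> c \<bullet> apex c P \<le> c \<bullet> x"
    using v min by auto
qed

lemma apex_mem: "pointed_polytope c P \<Longrightarrow> apex c P \<in> P"
  by (auto simp: pointed_polytope_def intro: apex_in)

text \<open>A vertex of \<open>P\<close> lying in \<open>F\<close> is a vertex of \<open>F\<close>,
  and minimality passes to subsets. This is what lets chains be cut down to faces without changing
  their apexes.\<close>

lemma apex_face:
  assumes "pointed_polytope c P" "F \<in> nonempty_faces P" "apex c P \<in> F"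
  shows "apex c F = apex c P"
proof (rule apex_eqI)
  have F: "F face_of P"
    using assms(2) by (auto simp: nonempty_faces_def)
  show "separates_vertices c F"
    using pointed_polytope_face[OF assms(1,2)] by (simp add: pointed_polytope_def)
  show "apex c P \<in> vertices F"
    using apex_minimal_vertex(1)[OF assms(1)] assms(3) by (simp add: vertices_face[OF F])
  show "\<And>x. x \<in> F \<Longrightarrow> c \<bullet> apex c P \<le> c \<bullet> x"
    using apex_minimal_vertex(2)[OF assms(1)] face_of_imp_subset[OF F] by blast
qed

section \<open>Chains of faces: restriction, independence of apexes, extension\<close>

lemma apex_chain_iff_sorted_wrt:
  "apex_chain c P Gs \<longleftrightarrow> set Gs \<subseteq> nonempty_faces P \<and>
     sorted_wrt (\<lambda>G H. H \<subset> G \<and> apex c G \<notin> H) Gs"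
proof -
  \<comment> \<open>If the apex of \<open>G\<close> misses \<open>H\<close>, it misses every subset
    of \<open>H\<close>. So the condition on neighbours holds for all pairs, and chains survive
    filtering.\<close>
  have "transp (\<lambda>G H. H \<subset> G \<and> apex c G \<notin> H)"
    by (rule transpI) blast
  then show ?thesis
    by (simp add: apex_chain_def sorted_wrt_iff_nth_Suc_transp)
qed

lemma apex_chain_Cons:
  "apex_chain c P (G # Gs) \<longleftrightarrow> G \<in> nonempty_faces P \<and> apex_chain c P Gs \<and>
     (\<forall>H\<in>set Gs. H \<subset> G \<and> apex c G \<notin> H)"
  by (auto simp: apex_chain_iff_sorted_wrt)

lemma apex_chain_face:
  assumes "F face_of P" "apex_chain c F Gs"
  shows "apex_chain c P Gs"
proof -
  have "nonempty_faces F \<subseteq> nonempty_faces P"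
    using assms(1) face_of_trans by (auto simp: nonempty_faces_def)
  then show ?thesis
    using assms(2) by (auto simp: apex_chain_iff_sorted_wrt)
qed

lemma apex_chain_subset_face:
  assumes "F face_of P" "apex_chain c P Gs" "\<And>G. G \<in> set Gs \<Longrightarrow> G \<subseteq> F"
  shows "apex_chain c F Gs"
proof -
  have "G \<in> nonempty_faces F" if "G \<in> set Gs" for G
    using assms(2) face_of_subset[OF _ assms(3)[OF that] face_of_imp_subset[OF assms(1)]] that
    by (auto simp: apex_chain_iff_sorted_wrt nonempty_faces_def)
  then show ?thesis
    using assms(2) by (auto simp: apex_chain_iff_sorted_wrt)
qed

lemma apex_chain_apexes_subset:
  assumes "pointed_polytope c P" "apex_chain c P Gs"
  shows "apex c ` set Gs \<subseteq> vertices P"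
proof
  fix v assume "v \<in> apex c ` set Gs"
  then obtain G where G: "G \<in> nonempty_faces P" "v = apex c G"
    using assms(2) by (auto simp: apex_chain_def)
  then have "v \<in> vertices G"
    using apex_minimal_vertex(1)[OF pointed_polytope_face[OF assms(1)]] by auto
  then show "v \<in> vertices P"
    using G(1) by (auto simp: nonempty_faces_def vertices_face)
qed

lemma vertices_subset: "vertices P \<subseteq> P"
  by (auto simp: vertices_def extreme_point_of_def)

text \<open>Drop the members whose apex lies outside \<open>F\<close> and intersect the others with
  \<open>F\<close>. The apexes stay the same by \<open>apex_face\<close>, and the inclusions stay
  strict because the apex of \<open>G\<close> lies in \<open>G\<close> and \<open>F\<close> but not
  in any later member.\<close>

lemma apex_chain_restrict:
  assumes "pointed_polytope c P" "F face_of P" "apex_chain c P Gs"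
  shows "\<exists>Hs. apex_chain c F Hs \<and> apex c ` set Gs \<inter> F \<subseteq> apex c ` set Hs"
proof -
  define Fs where "Fs = filter (\<lambda>G. apex c G \<in> F) Gs"
  have faces: "set Gs \<subseteq> nonempty_faces P"
    and sorted: "sorted_wrt (\<lambda>G H. H \<subset> G \<and> apex c G \<notin> H) Gs"
    using assms(3) by (auto simp: apex_chain_iff_sorted_wrt)
  have in_G: "apex c G \<in> G" "pointed_polytope c G" if "G \<in> set Fs" for G
    using that faces apex_mem pointed_polytope_face[OF assms(1)] by (auto simp: Fs_def)
  have face_G: "G \<inter> F \<in> nonempty_faces G" if "G \<in> set Fs" for G
  proof -
    have "G face_of P" "apex c G \<in> G \<inter> F"
      using that faces in_G[OF that] by (auto simp: Fs_def nonempty_faces_def)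
    then show ?thesis
      using face_of_Int[OF _ assms(2), of G] face_of_subset[of "G \<inter> F" P G]
      by (auto simp: nonempty_faces_def face_of_imp_subset)
  qed
  have face_F: "G \<inter> F \<in> nonempty_faces F" if "G \<in> set Fs" for G
  proof -
    have "G face_of P" "apex c G \<in> G \<inter> F"
      using that faces in_G[OF that] by (auto simp: Fs_def nonempty_faces_def)
    then show ?thesis
      using face_of_Int[OF _ assms(2), of G] face_of_subset[of "G \<inter> F" P F] assms(2)
      by (auto simp: nonempty_faces_def face_of_imp_subset)
  qed
  have apex_G: "apex c (G \<inter> F) = apex c G" if "G \<in> set Fs" for G
    using apex_face[OF in_G(2)[OF that] face_G[OF that]] that in_G(1)[OF that]
    by (simp add: Fs_def)
  have "sorted_wrt (\<lambda>G H. H \<subset> G \<and> apex c G \<notin> H) Fs"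
    unfolding Fs_def using sorted by (rule sorted_wrt_filter)
  then have "sorted_wrt (\<lambda>G H. H \<inter> F \<subset> G \<inter> F \<and> apex c (G \<inter> F) \<notin> H \<inter> F) Fs"
    by (rule sorted_wrt_mono_rel[rotated])
      (use in_G apex_G in \<open>auto simp: Fs_def\<close>)
  then have "apex_chain c F (map (\<lambda>G. G \<inter> F) Fs)"
    using face_F by (auto simp: apex_chain_iff_sorted_wrt sorted_wrt_map)
  moreover have "apex c ` set Gs \<inter> F \<subseteq> apex c ` set (map (\<lambda>G. G \<inter> F) Fs)"
  proof
    fix v assume "v \<in> apex c ` set Gs \<inter> F"
    then obtain G where "G \<in> set Fs" "v = apex c G"
      by (auto simp: Fs_def)
    then show "v \<in> apex c ` set (map (\<lambda>G. G \<inter> F) Fs)"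
      using apex_G[of G] by (intro image_eqI[of _ _ "G \<inter> F"]) auto
  qed
  ultimately show ?thesis by blast
qed

text \<open>Every member containing the apex of \<open>P\<close> has that point as its own apex.
  Replacing all such members by \<open>P\<close> itself therefore loses no apex.\<close>

lemma apex_chain_extend_top:
  assumes "pointed_polytope c P" "apex_chain c P Gs"
  shows "\<exists>Hs. apex_chain c P (P # Hs) \<and> apex c ` set Gs \<subseteq> apex c ` set (P # Hs)"
proof -
  define Hs where "Hs = filter (\<lambda>G. apex c P \<notin> G) Gs"
  have faces: "set Gs \<subseteq> nonempty_faces P"
    and "sorted_wrt (\<lambda>G H. H \<subset> G \<and> apex c G \<notin> H) Gs"
    using assms(2) by (auto simp: apex_chain_iff_sorted_wrt)
  then have "apex_chain c P Hs"
    by (auto simp: apex_chain_iff_sorted_wrt Hs_def intro: sorted_wrt_filter)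
  moreover have "H \<subset> P" "apex c P \<notin> H" if "H \<in> set Hs" for H
    using that faces apex_mem[OF assms(1)] nonempty_faces_subset[of H P]
    by (auto simp: Hs_def)
  ultimately have "apex_chain c P (P # Hs)"
    using pointed_polytope_self_face[OF assms(1)] by (auto simp: apex_chain_Cons)
  moreover have "apex c G \<in> apex c ` set (P # Hs)" if "G \<in> set Gs" for G
    using that faces apex_face[OF assms(1), of G] by (cases "apex c P \<in> G") (auto simp: Hs_def)
  ultimately show ?thesis by blast
qed

text \<open>Apexes are added from the smallest face upwards. Those already present lie in the next
  face \<open>H\<close>, whose affine hull meets \<open>P\<close> only in \<open>H\<close>; the new
  apex lies in \<open>P\<close> but outside \<open>H\<close>.\<close>

lemma apex_chain_affine_independent:
  assumes "pointed_polytope c P" "apex_chain c P Gs"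
  shows "\<not> affine_dependent (apex c ` set Gs) \<and> card (apex c ` set Gs) = length Gs"
  using assms(2)
proof (induction Gs)
  case (Cons G Gs)
  have chain: "G \<in> nonempty_faces P" "apex_chain c P Gs"
    and below: "\<And>H. H \<in> set Gs \<Longrightarrow> H \<subset> G \<and> apex c G \<notin> H"
    using Cons.prems by (auto simp: apex_chain_Cons)
  have IH: "\<not> affine_dependent (apex c ` set Gs)" "card (apex c ` set Gs) = length Gs"
    using Cons.IH[OF chain(2)] by auto
  have notin: "apex c G \<notin> affine hull (apex c ` set Gs)"
  proof (cases Gs)
    case (Cons H Hs)
    have H: "H \<in> nonempty_faces P" and sub: "\<And>K. K \<in> set Gs \<Longrightarrow> K \<subseteq> H"
      using chain(2) by (auto simp: Cons apex_chain_Cons)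
    have "apex c K \<in> K" if "K \<in> set Gs" for K
      using that chain(2) apex_mem pointed_polytope_face[OF assms(1)]
      by (auto simp: apex_chain_def)
    then have "affine hull (apex c ` set Gs) \<subseteq> affine hull H"
      using sub by (intro hull_mono) blast
    moreover have "H = affine hull H \<inter> P"
      using H face_of_imp_eq_affine_Int[OF pointed_polytope_convex[OF assms(1)]]
      by (auto simp: nonempty_faces_def)
    moreover have "apex c G \<in> P"
      using chain(1) apex_mem[OF pointed_polytope_face[OF assms(1) chain(1)]]
        nonempty_faces_subset[OF chain(1)] by blast
    moreover have "apex c G \<notin> H"
      using below Cons by auto
    ultimately show ?thesis by blast
  qed auto
  then have "apex c G \<notin> apex c ` set Gs"
    by (meson hull_inc)
  then show ?case
    using IH affine_independent_insert[OF IH(1) notin] by simp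
qed auto

text \<open>\<open>F\<close> is proper because the apex lies in \<open>P\<close> but not in
  \<open>F\<close>, and a proper nonempty face is the intersection of the facets containing
  it.\<close>

lemma exists_facet_avoiding_apex:
  assumes "pointed_polytope c P" "F \<in> nonempty_faces P" "apex c P \<notin> F"
  shows "\<exists>G. G facet_of P \<and> F \<subseteq> G \<and> apex c P \<notin> G"
proof -
  have F: "F face_of P" "F \<noteq> {}" "F \<noteq> P"
    using assms apex_mem by (auto simp: nonempty_faces_def)
  have "F = \<Inter>{G. G facet_of P \<and> F \<subseteq> G}"
    using face_of_polyhedron[OF _ F] assms(1)
    by (auto simp: pointed_polytope_def polytope_imp_polyhedron)
  then show ?thesis
    using assms(3) by blast
qed

lemma facet_nonempty_face: "F facet_of P \<Longrightarrow> F \<in> nonempty_faces P"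
  by (auto simp: facet_of_def nonempty_faces_def)

text \<open>Induction on the dimension: put \<open>P\<close> on top, choose a facet that contains
  the rest of the chain and avoids the apex of \<open>P\<close>, and extend the rest inside that
  facet.\<close>

lemma apex_chain_extend_full:
  assumes "pointed_polytope c P" "aff_dim P = int d" "apex_chain c P Gs"
  shows "\<exists>Hs. apex_chain c P Hs \<and> length Hs = Suc d \<and> apex c ` set Gs \<subseteq> apex c ` set Hs"
  using assms
proof (induction d arbitrary: P Gs)
  case 0
  obtain Hs where Hs: "apex_chain c P (P # Hs)" "apex c ` set Gs \<subseteq> apex c ` set (P # Hs)"
    using apex_chain_extend_top[OF 0(1,3)] by blast
  obtain a where a: "P = {a}"
    using 0(2) aff_dim_eq_0 by auto
  \<comment> \<open>Below a point there is only the empty face, which chains exclude.\<close>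
  have "H = {}" if "H \<in> set Hs" for H
    using that Hs(1) a by (auto simp: apex_chain_Cons)
  moreover have "H \<noteq> {}" if "H \<in> set Hs" for H
    using that Hs(1) by (auto simp: apex_chain_def nonempty_faces_def)
  ultimately have "Hs = []"
    by (cases Hs) auto
  then show ?case
    using Hs by force
next
  case (Suc d)
  obtain Hs where Hs: "apex_chain c P (P # Hs)" "apex c ` set Gs \<subseteq> apex c ` set (P # Hs)"
    using apex_chain_extend_top[OF Suc(2,4)] by blast
  have "\<exists>F. F \<in> nonempty_faces P \<and> apex c P \<notin> F \<and> (\<forall>H\<in>set Hs. H \<subseteq> F)"
  proof (cases Hs)
    case Nil
    \<comment> \<open>Nothing lies below \<open>P\<close> yet. Having positive dimension,
      \<open>P\<close> has a second vertex, which serves as a face avoiding the apex.\<close>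
    obtain w where "w \<in> vertices P" "w \<noteq> apex c P"
    proof (rule ccontr)
      assume "\<not> thesis"
      then have "vertices P \<subseteq> {apex c P}"
        using that by blast
      moreover have "P = convex hull vertices P"
        unfolding vertices_def using Suc(2)
        by (intro Krein_Milman_Minkowski)
          (auto simp: pointed_polytope_def polytope_imp_compact polytope_imp_convex)
      ultimately have "P \<subseteq> {apex c P}"
        by (metis convex_hull_singleton hull_mono)
      then have "aff_dim P \<le> 0"
        using aff_dim_subset[of P "{apex c P}"] by simp
      then show False
        using Suc(3) by simp
    qed
    then show ?thesis
      using Nil by (intro exI[of _ "{w}"])
        (auto simp: nonempty_faces_def vertices_def face_of_singleton)
  next
    case (Cons H Ks)
    then show ?thesis
      using Hs(1) by (intro exI[of _ H]) (auto simp: apex_chain_Cons)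
  qed
  then obtain F where F: "F \<in> nonempty_faces P" "apex c P \<notin> F" "\<And>H. H \<in> set Hs \<Longrightarrow> H \<subseteq> F"
    by blast
  obtain G where G: "G facet_of P" "F \<subseteq> G" "apex c P \<notin> G"
    using exists_facet_avoiding_apex[OF Suc(2) F(1,2)] by blast
  have faceG: "G face_of P"
    using G(1) by (simp add: facet_of_def)
  have "apex_chain c G Hs"
    using Hs(1) F(3) G(2) by (intro apex_chain_subset_face[OF faceG]) (auto simp: apex_chain_Cons)
  moreover have "aff_dim G = int d"
    using G(1) Suc(3) by (simp add: facet_of_def)
  ultimately obtain Ks where Ks: "apex_chain c G Ks" "length Ks = Suc d"
    "apex c ` set Hs \<subseteq> apex c ` set Ks"
    using Suc.IH pointed_polytope_face[OF Suc(2) facet_nonempty_face[OF G(1)]] by blast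
  have "K \<subseteq> G" if "K \<in> set Ks" for K
    using that Ks(1) nonempty_faces_subset[of K G] by (auto simp: apex_chain_def)
  then have "K \<subset> P \<and> apex c P \<notin> K" if "K \<in> set Ks" for K
    using that G(3) face_of_imp_subset[OF faceG] apex_mem[OF Suc(2)] by blast
  then have "apex_chain c P (P # Ks)"
    using apex_chain_face[OF faceG Ks(1)] pointed_polytope_self_face[OF Suc(2)]
    by (auto simp: apex_chain_Cons)
  moreover have "apex c ` set Gs \<subseteq> apex c ` set (P # Ks)"
    using Hs(2) Ks(3) by auto
  ultimately show ?case
    using Ks(2) by (intro exI[of _ "P # Ks"]) auto
qed

section \<open>Averages of multisets in convex sets and faces\<close>

lemma sum_mset_average_convex:
  assumes "convex S" "set_mset M \<subseteq> S" "M \<noteq> {#}"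
  shows "sum_mset M /\<^sub>R real (size M) \<in> S"
  using assms(2,3)
proof (induction M)
  case (add v M)
  show ?case
  proof (cases "M = {#}")
    case False
    define m where "m = real (size M)"
    have m: "m > 0"
      using False by (simp add: m_def nonempty_has_size)
    have size: "real (size (add_mset v M)) = m + 1"
      by (simp add: m_def)
    \<comment> \<open>The new average is a convex combination of the new point and the old average,
      weighted by the numbers of summands.\<close>
    have "(1 / (m + 1)) *\<^sub>R v + (m / (m + 1)) *\<^sub>R (sum_mset M /\<^sub>R m) \<in> S"
      using add False m by (intro convexD[OF assms(1)]) (auto simp: m_def field_simps)
    also have "(1 / (m + 1)) *\<^sub>R v + (m / (m + 1)) *\<^sub>R (sum_mset M /\<^sub>R m) =
        sum_mset (add_mset v M) /\<^sub>R real (size (add_mset v M))"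
      using m unfolding size by (simp add: scaleR_add_right divide_inverse add.commute)
    finally show ?thesis .
  qed (use add in auto)
qed auto

text \<open>Split off one summand \<open>v\<close>. The total average lies strictly between
  \<open>v\<close> and the average \<open>w\<close> of the others, so a face containing it contains
  \<open>v\<close>; if \<open>v = w\<close>, the total average is \<open>v\<close> itself.\<close>

lemma sum_mset_average_in_face:
  assumes "convex P" "F face_of P" "set_mset M \<subseteq> P" "sum_mset M /\<^sub>R real (size M) \<in> F"
  shows "set_mset M \<subseteq> F"
proof
  fix v assume "v \<in># M"
  then obtain N where M: "M = add_mset v N"
    by (metis mset_add)
  show "v \<in> F"
  proof (cases "N = {#}")
    case True
    then show ?thesis using assms(4) M by simp
  next
    case False
    define m where "m = real (size N)"
    define w where "w = sum_mset N /\<^sub>R m"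
    have m: "m > 0"
      using False by (simp add: m_def nonempty_has_size)
    have P: "w \<in> P" "v \<in> P"
      using sum_mset_average_convex[OF assms(1), of N] False assms(3) by (auto simp: M w_def m_def)
    have size: "real (size M) = m + 1"
      by (simp add: M m_def)
    have coeff: "1 - m / (m + 1) = inverse (m + 1)"
      using m by (simp add: field_simps)
    have avg: "sum_mset M /\<^sub>R real (size M) = (1 - m / (m + 1)) *\<^sub>R v + (m / (m + 1)) *\<^sub>R w"
      unfolding size coeff using m by (simp add: M w_def scaleR_add_right divide_inverse add.commute)
    show ?thesis
    proof (cases "v = w")
      case True
      then show ?thesis
        using assms(4) avg by (simp add: scaleR_left_distrib[symmetric])
    next
      case False
      have "sum_mset M /\<^sub>R real (size M) \<in> open_segment v w"
        unfolding in_segment using avg m False by (intro conjI exI[of _ "m / (m + 1)"]) auto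
      then show ?thesis
        using face_ofD[OF assms(2) _ _ _ assms(4)] P by blast
    qed
  qed
qed

section \<open>Relative interiors of faces and the boundary\<close>

lemma exists_face_rel_interior:
  assumes "polytope P" "x \<in> P"
  shows "\<exists>F\<in>nonempty_faces P. x \<in> rel_interior F"
proof -
  \<comment> \<open>The required face is a minimal one containing \<open>x\<close>: were
    \<open>x\<close> not in its relative interior, a facet of it would be a smaller face containing
    \<open>x\<close>.\<close>
  define S where "S = {F. F face_of P \<and> x \<in> F}"
  have "finite S" "P \<in> S"
    using assms finite_polytope_faces[OF assms(1)]
    by (auto simp: S_def polytope_imp_convex face_of_refl)
  then obtain F where F: "F \<in> S" and min: "\<And>G. G \<in> S \<Longrightarrow> G \<subseteq> F \<Longrightarrow> G = F"
    using finite_has_minimal2[of S P] by blast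
  have "x \<in> rel_interior F"
  proof (rule ccontr)
    assume "x \<notin> rel_interior F"
    moreover have "polyhedron F"
      using F face_of_polytope_polytope[OF assms(1)] by (simp add: S_def polytope_imp_polyhedron)
    ultimately obtain G where G: "G facet_of F" "x \<in> G"
      using F rel_boundary_of_polyhedron[of F] by (auto simp: S_def)
    then have "G face_of P"
      using F face_of_trans[of G F P] by (auto simp: S_def facet_of_def)
    then have "G = F"
      using G by (intro min) (auto simp: S_def facet_of_imp_subset)
    then show False
      using G(1) by (simp add: facet_of_def)
  qed
  then show ?thesis
    using F by (auto simp: S_def nonempty_faces_def)
qed

lemma polytope_boundary:
  assumes "polytope P"
  shows "boundary P = P - rel_interior P" "boundary P = \<Union>{F. F facet_of P}"
proof -
  have "boundary P = rel_frontier P"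
    using rel_frontier_of_polyhedron_alt[OF polytope_imp_polyhedron[OF assms]]
    by (simp add: boundary_def)
  then show "boundary P = P - rel_interior P" "boundary P = \<Union>{F. F facet_of P}"
    using rel_boundary_of_polyhedron[OF polytope_imp_polyhedron[OF assms]]
      rel_frontier_of_polyhedron[OF polytope_imp_polyhedron[OF assms]] by auto
qed

section \<open>Sums along chains and their splitting by faces\<close>

definition chain_sums :: "'a::euclidean_space \<Rightarrow> 'a set \<Rightarrow> nat \<Rightarrow> 'a set" where
  "chain_sums c P m = {sum_mset M | M.
     size M = m \<and> (\<exists>Gs. apex_chain c P Gs \<and> set_mset M \<subseteq> apex c ` set Gs)}"

text \<open>For \<open>m = 0\<close> the quotient is 0 by convention, whatever the position of
  \<open>P\<close>. Only \<open>m > 0\<close> gives a geometric meaning, which explains that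
  hypothesis in the lemmas below.\<close>

definition interior_chain_sums :: "'a::euclidean_space \<Rightarrow> 'a set \<Rightarrow> nat \<Rightarrow> 'a set" where
  "interior_chain_sums c P m = {y \<in> chain_sums c P m. y /\<^sub>R real m \<in> rel_interior P}"

lemma chain_sumsI:
  "apex_chain c P Gs \<Longrightarrow> set_mset M \<subseteq> apex c ` set Gs \<Longrightarrow> size M = m \<Longrightarrow>
    sum_mset M \<in> chain_sums c P m"
  unfolding chain_sums_def by blast

lemma chain_sums_0: "chain_sums c P 0 = {0}"
proof -
  have "apex_chain c P []"
    by (simp add: apex_chain_def)
  then show ?thesis
    by (auto simp: chain_sums_def intro!: exI[of _ "[]"])
qed

lemma finite_chain_sums:
  assumes "pointed_polytope c P"
  shows "finite (chain_sums c P m)"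
proof (rule finite_subset)
  show "chain_sums c P m \<subseteq> sum_mset ` multisets_of_size (vertices P) m"
    using apex_chain_apexes_subset[OF assms]
    by (fastforce simp: chain_sums_def multisets_of_size_def)
  have "finite (vertices P)"
    using assms by (simp add: pointed_polytope_def finite_vertices)
  then show "finite (sum_mset ` multisets_of_size (vertices P) m)"
    by (intro finite_imageI finite_multisets_of_size)
qed

lemma chain_sums_average:
  assumes "pointed_polytope c P" "m > 0" "y \<in> chain_sums c P m"
  shows "y /\<^sub>R real m \<in> P"
proof -
  obtain M Gs where M: "y = sum_mset M" "size M = m" "apex_chain c P Gs"
    "set_mset M \<subseteq> apex c ` set Gs"
    using assms(3) by (auto simp: chain_sums_def)
  then have "set_mset M \<subseteq> P"
    using apex_chain_apexes_subset[OF assms(1) M(3)] vertices_subset[of P] by blast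
  then show ?thesis
    using sum_mset_average_convex[OF pointed_polytope_convex[OF assms(1)], of M] M(1,2) assms(2)
    by (cases "M = {#}") auto
qed

text \<open>If an average lies in \<open>F\<close>, so do all its summands, and the apexes of a
  chain that lie in \<open>F\<close> belong to a chain of \<open>F\<close>. For \<open>m = 0\<close>
  the equation would fail when 0 is not in \<open>F\<close>.\<close>

lemma chain_sums_face:
  assumes "pointed_polytope c P" "F \<in> nonempty_faces P" "m > 0"
  shows "chain_sums c F m = {y \<in> chain_sums c P m. y /\<^sub>R real m \<in> F}"
proof (intro equalityI subsetI CollectI conjI)
  have F: "F face_of P"
    using assms(2) by (simp add: nonempty_faces_def)
  fix y
  {
    assume y: "y \<in> chain_sums c F m"
    show "y \<in> chain_sums c P m"
      using y apex_chain_face[OF F] by (auto simp: chain_sums_def)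
    show "y /\<^sub>R real m \<in> F"
      by (rule chain_sums_average[OF pointed_polytope_face[OF assms(1,2)] assms(3) y])
  }
  assume "y \<in> {y \<in> chain_sums c P m. y /\<^sub>R real m \<in> F}"
  then obtain M Gs where M: "y = sum_mset M" "size M = m" "apex_chain c P Gs"
    "set_mset M \<subseteq> apex c ` set Gs" "y /\<^sub>R real m \<in> F"
    by (auto simp: chain_sums_def)
  have "set_mset M \<subseteq> P"
    using M(4) apex_chain_apexes_subset[OF assms(1) M(3)] vertices_subset[of P] by blast
  then have "set_mset M \<subseteq> F"
    using sum_mset_average_in_face[OF pointed_polytope_convex[OF assms(1)] F] M by auto
  moreover obtain Hs where "apex_chain c F Hs" "apex c ` set Gs \<inter> F \<subseteq> apex c ` set Hs"
    using apex_chain_restrict[OF assms(1) F M(3)] by blast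
  ultimately have "set_mset M \<subseteq> apex c ` set Hs" "apex_chain c F Hs"
    using M(4) by auto
  then show "y \<in> chain_sums c F m"
    using M(1,2) by (auto intro: chain_sumsI)
qed

lemma interior_chain_sums_face:
  assumes "pointed_polytope c P" "F \<in> nonempty_faces P" "m > 0"
  shows "interior_chain_sums c F m = {y \<in> chain_sums c P m. y /\<^sub>R real m \<in> rel_interior F}"
  using rel_interior_subset[of F]
  by (auto simp: interior_chain_sums_def chain_sums_face[OF assms])

lemma chain_sums_decomposition:
  assumes "pointed_polytope c P" "m > 0"
  shows "chain_sums c P m = (\<Union>F\<in>nonempty_faces P. interior_chain_sums c F m)"
proof -
  have "polytope P"
    using assms(1) by (simp add: pointed_polytope_def)
  then have "\<exists>F\<in>nonempty_faces P. y /\<^sub>R real m \<in> rel_interior F" if "y \<in> chain_sums c P m" for y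
    using exists_face_rel_interior chain_sums_average[OF assms that] by blast
  then show ?thesis
    by (auto simp: interior_chain_sums_face[OF assms(1) _ assms(2)])
qed

text \<open>Distinct faces have disjoint relative interiors, so no sum is counted twice.\<close>

lemma card_UN_interior_chain_sums:
  assumes "pointed_polytope c P" "m > 0" "S \<subseteq> nonempty_faces P"
  shows "card (\<Union>F\<in>S. interior_chain_sums c F m) = (\<Sum>F\<in>S. card (interior_chain_sums c F m))"
proof (rule card_UN_disjoint)
  show "finite S"
    using finite_subset[OF assms(3) finite_nonempty_faces[OF assms(1)]] .
  show "\<forall>F\<in>S. finite (interior_chain_sums c F m)"
    using assms(3) finite_chain_sums[OF assms(1)]
    by (auto simp: interior_chain_sums_face[OF assms(1) _ assms(2)])
  show "\<forall>F\<in>S. \<forall>G\<in>S. F \<noteq> G \<longrightarrow> interior_chain_sums c F m \<inter> interior_chain_sums c G m = {}"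
  proof (intro ballI impI)
    fix F G assume FG: "F \<in> S" "G \<in> S" "F \<noteq> G"
    then have "rel_interior F \<inter> rel_interior G = {}"
      using assms(3) face_of_eq[of F P G] by (auto simp: nonempty_faces_def)
    then show "interior_chain_sums c F m \<inter> interior_chain_sums c G m = {}"
      by (auto simp: interior_chain_sums_def)
  qed
qed

text \<open>A sum that uses the apex of \<open>P\<close> is a translate of a shorter sum; any other
  sum lives in a face avoiding the apex. Conversely, the apex may be added to every sum, since every
  chain can be made to start with \<open>P\<close>.\<close>

lemma chain_sums_Suc:
  assumes "pointed_polytope c P"
  shows "chain_sums c P (Suc m) = (+) (apex c P) ` chain_sums c P m \<union>
    (\<Union>F\<in>{F \<in> nonempty_faces P. apex c P \<notin> F}. interior_chain_sums c F (Suc m))"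
    (is "?L = ?A \<union> ?B")
proof (intro equalityI subsetI)
  fix y assume "y \<in> ?L"
  then obtain M Gs where M: "y = sum_mset M" "size M = Suc m" "apex_chain c P Gs"
    "set_mset M \<subseteq> apex c ` set Gs"
    by (auto simp: chain_sums_def)
  obtain Hs where Hs: "apex_chain c P (P # Hs)" "apex c ` set Gs \<subseteq> apex c ` set (P # Hs)"
    using apex_chain_extend_top[OF assms M(3)] by blast
  show "y \<in> ?A \<union> ?B"
  proof (cases "apex c P \<in># M")
    case True
    then obtain N where N: "M = add_mset (apex c P) N"
      by (metis mset_add)
    then have "sum_mset N \<in> chain_sums c P m"
      using M by (intro chain_sumsI[of c P Gs]) auto
    then show ?thesis
      using M(1) N by auto
  next
    case False
    have "set_mset M \<subseteq> insert (apex c P) (apex c ` set Hs)"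
      using M(4) Hs(2) by auto
    with False have sub: "set_mset M \<subseteq> apex c ` set Hs"
      by blast
    have "M \<noteq> {#}"
      using M(2) by auto
    \<comment> \<open>\<open>H\<close> is the largest member below \<open>P\<close>. All of
      \<open>Hs\<close> is a chain of \<open>H\<close>, and no face of \<open>H\<close> contains the
      apex of \<open>P\<close>.\<close>
    then obtain H Ks where H: "Hs = H # Ks"
      using sub by (cases Hs) auto
    have face: "H \<in> nonempty_faces P" and notin: "apex c P \<notin> H"
      using Hs(1) by (auto simp: H apex_chain_Cons)
    have "apex_chain c H Hs"
      using Hs(1) face
      by (intro apex_chain_subset_face[of H P])
        (auto simp: H apex_chain_Cons nonempty_faces_def)
    then have "y \<in> chain_sums c H (Suc m)"
      using sub M(1,2) by (auto intro: chain_sumsI)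
    then obtain F where F: "F \<in> nonempty_faces H" "y \<in> interior_chain_sums c F (Suc m)"
      using chain_sums_decomposition[OF pointed_polytope_face[OF assms face], of "Suc m"] by auto
    then have "F \<in> nonempty_faces P" "apex c P \<notin> F"
      using nonempty_faces_trans[OF face] nonempty_faces_subset[OF F(1)] notin by auto
    then show ?thesis
      using F(2) by blast
  qed
next
  fix y assume "y \<in> ?A \<union> ?B"
  then show "y \<in> ?L"
  proof
    assume "y \<in> ?A"
    then obtain M Gs where M: "y = apex c P + sum_mset M" "size M = m" "apex_chain c P Gs"
      "set_mset M \<subseteq> apex c ` set Gs"
      by (auto simp: chain_sums_def)
    obtain Hs where Hs: "apex_chain c P (P # Hs)" "apex c ` set Gs \<subseteq> apex c ` set (P # Hs)"
      using apex_chain_extend_top[OF assms M(3)] by blast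
    then have "set_mset (add_mset (apex c P) M) \<subseteq> apex c ` set (P # Hs)"
      using M(4) by auto
    then show ?thesis
      using M(1,2) chain_sumsI[OF Hs(1), of "add_mset (apex c P) M"] by simp
  next
    assume "y \<in> ?B"
    then show ?thesis
      using interior_chain_sums_face[OF assms, of _ "Suc m"] by auto
  qed
qed

text \<open>This makes the two pieces of \<open>chain_sums_Suc\<close> disjoint: an average with the
  apex among its summands can lie in a face only if the apex does.\<close>

lemma apex_translate_notin_face:
  assumes "pointed_polytope c P" "F \<in> nonempty_faces P" "apex c P \<notin> F" "y \<in> chain_sums c P m"
  shows "(apex c P + y) /\<^sub>R real (Suc m) \<notin> F"
proof
  assume avg: "(apex c P + y) /\<^sub>R real (Suc m) \<in> F"
  obtain M Gs where M: "y = sum_mset M" "size M = m" "apex_chain c P Gs"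
    "set_mset M \<subseteq> apex c ` set Gs"
    using assms(4) by (auto simp: chain_sums_def)
  have "set_mset (add_mset (apex c P) M) \<subseteq> P"
    using M(4) apex_chain_apexes_subset[OF assms(1) M(3)] vertices_subset[of P]
      apex_mem[OF assms(1)] by auto
  moreover have "F face_of P"
    using assms(2) by (simp add: nonempty_faces_def)
  moreover have "sum_mset (add_mset (apex c P) M) /\<^sub>R real (size (add_mset (apex c P) M)) \<in> F"
    using avg M(1,2) by simp
  ultimately have "set_mset (add_mset (apex c P) M) \<subseteq> F"
    using sum_mset_average_in_face[OF pointed_polytope_convex[OF assms(1)]] by blast
  then show False
    using assms(3) by simp
qed

text \<open>Counterpart of the recursion for \<open>polytope_number\<close>: the pieces are disjoint
  and translation is injective.\<close>

lemma card_chain_sums_Suc: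
  assumes "pointed_polytope c P"
  shows "card (chain_sums c P (Suc m)) = card (chain_sums c P m) +
    (\<Sum>F\<in>{F \<in> nonempty_faces P. apex c P \<notin> F}. card (interior_chain_sums c F (Suc m)))"
proof -
  let ?S = "{F \<in> nonempty_faces P. apex c P \<notin> F}"
  have "(+) (apex c P) ` chain_sums c P m \<inter> (\<Union>F\<in>?S. interior_chain_sums c F (Suc m)) = {}"
    using apex_translate_notin_face[OF assms, where m = m]
    by (auto simp: interior_chain_sums_def dest: rel_interior_subset[THEN subsetD])
  moreover have "finite (\<Union>F\<in>?S. interior_chain_sums c F (Suc m))"
    by (rule finite_subset[OF _ finite_chain_sums[OF assms, of "Suc m"]])
      (auto simp: chain_sums_Suc[OF assms])
  ultimately show ?thesis
    using card_UN_interior_chain_sums[OF assms, of "Suc m" ?S]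
    by (simp add: chain_sums_Suc[OF assms] card_Un_disjoint finite_chain_sums[OF assms]
        card_image)
qed

text \<open>Counterpart of the recursion for \<open>interior_polytope_number\<close>, obtained by
  isolating the term \<open>F = P\<close> in the decomposition.\<close>

lemma card_interior_chain_sums:
  assumes "pointed_polytope c P" "m > 0"
  shows "card (chain_sums c P m) = card (interior_chain_sums c P m) +
    (\<Sum>F\<in>nonempty_faces P - {P}. card (interior_chain_sums c F m))"
  using chain_sums_decomposition[OF assms] card_UN_interior_chain_sums[OF assms order_refl]
    sum.remove[OF finite_nonempty_faces[OF assms(1)] pointed_polytope_self_face[OF assms(1)],
      of "\<lambda>F. card (interior_chain_sums c F m)"]
  by simp

section \<open>Polytope numbers as cardinalities\<close>

lemma nonempty_faces_aff_dim_0: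
  assumes "pointed_polytope c P" "aff_dim P = 0" "F \<in> nonempty_faces P"
  shows "F = P"
  using assms aff_dim_eq_0[of P] nonempty_faces_subset[OF assms(3)]
  by (auto simp: nonempty_faces_def)

text \<open>Outer induction on the dimension, inner induction on \<open>m\<close> for the polytope
  numbers; the interior numbers then follow by subtraction. The interior claim needs
  \<open>m > 0\<close>, since for \<open>m = 0\<close> it would depend on whether 0 lies in the
  relative interior of \<open>P\<close>.\<close>

theorem polytope_number_eq_card:
  assumes "pointed_polytope c P"
  shows "polytope_number c P (Suc m) = int (card (chain_sums c P m))"
    and "m > 0 \<Longrightarrow> interior_polytope_number c P (Suc m) = int (card (interior_chain_sums c P m))"
proof -
  have "(\<forall>m. polytope_number c P (Suc m) = int (card (chain_sums c P m))) \<and>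
    (\<forall>m>0. interior_polytope_number c P (Suc m) = int (card (interior_chain_sums c P m)))"
    using assms
  proof (induction "nat (aff_dim P)" arbitrary: P rule: less_induct)
    case less
    have P: "polytope P" "P \<noteq> {}" "separates_vertices c P"
      using less.prems by (auto simp: pointed_polytope_def)
    have IH: "interior_polytope_number c F (Suc m) = int (card (interior_chain_sums c F m))"
      if "F \<in> nonempty_faces P" "F \<noteq> P" "m > 0" for F m
    proof -
      have "aff_dim F < aff_dim P"
        using that by (intro face_of_aff_dim_lt polytope_imp_convex P) (auto simp: nonempty_faces_def)
      moreover have "0 \<le> aff_dim F"
        using that(1) aff_dim_negative_iff[of F] by (simp add: nonempty_faces_def not_less[symmetric])
      ultimately show ?thesis
        using less.hyps[of F] pointed_polytope_face[OF less.prems that(1)] that(3) by simp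
    qed
    have num: "polytope_number c P (Suc m) = int (card (chain_sums c P m))" for m
    proof (induction m)
      case 0
      then show ?case
        using P by (simp add: polytope_number.simps[of c P] chain_sums_0)
    next
      case (Suc m)
      let ?S = "{F \<in> nonempty_faces P. apex c P \<notin> F}"
      show ?case
      proof (cases "aff_dim P = 0")
        case True
        \<comment> \<open>The only nonempty face of a point contains its apex, so the count stays at
          1, matching the separate clause for dimension 0.\<close>
        have "?S = {}"
          using nonempty_faces_aff_dim_0[OF less.prems True] apex_mem[OF less.prems] by auto
        then have "card (chain_sums c P (Suc m)) = card (chain_sums c P m)"
          by (simp only: card_chain_sums_Suc[OF less.prems]) simp
        then show ?thesis
          using Suc True P by (simp add: polytope_number.simps[of c P])
      next
        case False
        \<comment> \<open>Faces avoiding the apex are proper, so the outer induction hypothesis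
          covers every term.\<close>
        have "F \<noteq> P" if "F \<in> ?S" for F
          using that apex_mem[OF less.prems] by auto
        then have "(\<Sum>F\<in>?S. interior_polytope_number c F (Suc (Suc m))) =
            (\<Sum>F\<in>?S. int (card (interior_chain_sums c F (Suc m))))"
          by (intro sum.cong refl IH) auto
        then show ?thesis
          using Suc False P
          by (simp add: polytope_number.simps[of c P "Suc (Suc m)"] card_chain_sums_Suc[OF less.prems])
      qed
    qed
    have "interior_polytope_number c P (Suc m) = int (card (interior_chain_sums c P m))"
      if "m > 0" for m
    proof (cases "aff_dim P = 0")
      case True
      have "nonempty_faces P - {P} = {}"
        using nonempty_faces_aff_dim_0[OF less.prems True] by auto
      then have "card (interior_chain_sums c P m) = card (chain_sums c P m)"
        by (simp only: card_interior_chain_sums[OF less.prems that]) simp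
      then show ?thesis
        using num[of m] True P
        by (simp add: polytope_number.simps[of c P] interior_polytope_number.simps[of c P])
    next
      case False
      have "(\<Sum>F\<in>nonempty_faces P - {P}. interior_polytope_number c F (Suc m)) =
          (\<Sum>F\<in>nonempty_faces P - {P}. int (card (interior_chain_sums c F m)))"
        using that by (intro sum.cong refl IH) auto
      then show ?thesis
        using False P that num[of m] card_interior_chain_sums[OF less.prems that]
        by (simp add: interior_polytope_number.simps[of c P "Suc m"])
    qed
    then show ?case
      using num by blast
  qed
  then show "polytope_number c P (Suc m) = int (card (chain_sums c P m))"
    and "m > 0 \<Longrightarrow> interior_polytope_number c P (Suc m) = int (card (interior_chain_sums c P m))"
    by auto
qed

section \<open>Point arrangements as sums along chains\<close>

lemma sum_mset_eq_sum_count: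
  fixes M :: "'a::real_vector multiset"
  assumes "finite V" "set_mset M \<subseteq> V"
  shows "sum_mset M = (\<Sum>w\<in>V. real (count M w) *\<^sub>R w)"
  using assms(2)
proof (induction M)
  case (add v M)
  have "(\<Sum>w\<in>V. real (count (add_mset v M) w) *\<^sub>R w) =
      (\<Sum>w\<in>V. real (count M w) *\<^sub>R w + (if w = v then w else 0))"
    by (intro sum.cong) (auto simp: scaleR_left_distrib)
  then show ?case
    using add assms(1) by (simp add: sum.distrib add.commute)
qed auto

lemma size_eq_sum_count:
  assumes "finite V" "set_mset M \<subseteq> V"
  shows "size M = (\<Sum>w\<in>V. count M w)"
  unfolding size_multiset_overloaded_eq
  using assms by (intro sum.mono_neutral_left) (auto simp: not_in_iff)

lemma point_arrangement_eq_sum_mset: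
  assumes "finite (vertices \<alpha>)"
  shows "point_arrangement \<alpha> (Suc m) = sum_mset ` multisets_of_size (vertices \<alpha>) m"
proof (intro equalityI subsetI)
  fix y assume "y \<in> point_arrangement \<alpha> (Suc m)"
  then obtain x :: "'a \<Rightarrow> nat" where x: "y = (\<Sum>w\<in>vertices \<alpha>. real (x w) *\<^sub>R w)"
    "(\<Sum>w\<in>vertices \<alpha>. x w) = m"
    by (auto simp: point_arrangement_def)
  \<comment> \<open>The coefficients become multiplicities. Outside the vertices \<open>x\<close> is
    arbitrary, so it is cut off there to get finite support.\<close>
  define M where "M = Abs_multiset (\<lambda>w. if w \<in> vertices \<alpha> then x w else 0)"
  have count: "count M w = (if w \<in> vertices \<alpha> then x w else 0)" for w
    unfolding M_def using assms by (subst count_Abs_multiset) (auto intro: finite_subset[rotated])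
  then have sub: "set_mset M \<subseteq> vertices \<alpha>"
    by (auto simp: set_mset_def split: if_splits)
  have "sum_mset M = y" "size M = m"
    using sum_mset_eq_sum_count[OF assms sub] size_eq_sum_count[OF assms sub] x
    by (simp_all add: count)
  then show "y \<in> sum_mset ` multisets_of_size (vertices \<alpha>) m"
    using sub by (auto simp: multisets_of_size_def)
next
  fix y assume "y \<in> sum_mset ` multisets_of_size (vertices \<alpha>) m"
  then obtain M where M: "y = sum_mset M" "set_mset M \<subseteq> vertices \<alpha>" "size M = m"
    by (auto simp: multisets_of_size_def)
  then show "y \<in> point_arrangement \<alpha> (Suc m)"
    using sum_mset_eq_sum_count[OF assms M(2)] size_eq_sum_count[OF assms M(2)]
    by (auto simp: point_arrangement_def intro!: exI[of _ "count M"])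
qed

lemma vertices_chain_simplex:
  assumes "pointed_polytope c P" "apex_chain c P Gs"
  shows "vertices (convex hull (apex c ` set Gs)) = apex c ` set Gs"
  using apex_chain_affine_independent[OF assms]
  by (auto simp: vertices_def extreme_point_of_convex_hull_affine_independent)

text \<open>By affine independence a chain of length \<open>k + 1\<close> spans a simplex of
  dimension exactly \<open>k\<close>; independence inside \<open>P\<close> also yields the length
  bound demanded by \<open>pointed_triangulation\<close>.\<close>

lemma simplexes_pointed_triangulation:
  assumes "pointed_polytope c P"
  shows "simplexes_of_dim (int k) (pointed_triangulation c P) =
    {convex hull (apex c ` set Gs) | Gs. apex_chain c P Gs \<and> length Gs = Suc k}"
proof (intro equalityI subsetI)
  fix \<alpha> assume \<alpha>: "\<alpha> \<in> simplexes_of_dim (int k) (pointed_triangulation c P)"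
  then have simplex: "int k simplex \<alpha>"
    by (simp add: simplexes_of_dim_def)
  then have "\<alpha> \<noteq> {}" by auto
  then obtain Gs where Gs: "\<alpha> = convex hull (apex c ` set Gs)" "apex_chain c P Gs"
    using \<alpha> by (auto simp: simplexes_of_dim_def pointed_triangulation_def)
  have "int (length Gs) = aff_dim \<alpha> + 1"
    using apex_chain_affine_independent[OF assms Gs(2)] aff_dim_affine_independent[of "apex c ` set Gs"]
    by (simp add: Gs(1) aff_dim_convex_hull)
  then have "length Gs = Suc k"
    using aff_dim_simplex[OF simplex] by simp
  then show "\<alpha> \<in> {convex hull (apex c ` set Gs) | Gs. apex_chain c P Gs \<and> length Gs = Suc k}"
    using Gs by blast
next
  fix \<alpha> assume "\<alpha> \<in> {convex hull (apex c ` set Gs) | Gs. apex_chain c P Gs \<and> length Gs = Suc k}"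
  then obtain Gs where Gs: "\<alpha> = convex hull (apex c ` set Gs)" "apex_chain c P Gs" "length Gs = Suc k"
    by blast
  have ind: "\<not> affine_dependent (apex c ` set Gs)" "card (apex c ` set Gs) = length Gs"
    using apex_chain_affine_independent[OF assms Gs(2)] by auto
  have "apex c ` set Gs \<subseteq> P"
    using apex_chain_apexes_subset[OF assms Gs(2)] vertices_subset[of P] by blast
  then have "int (length Gs) \<le> aff_dim P + 1"
    using independent_card_le_aff_dim[of "apex c ` set Gs" P] ind by simp
  moreover have "int k simplex \<alpha>"
    unfolding Gs(1) by (rule simplex_convex_hull) (use ind Gs(3) in simp)
  ultimately show "\<alpha> \<in> simplexes_of_dim (int k) (pointed_triangulation c P)"
    using Gs by (auto simp: simplexes_of_dim_def pointed_triangulation_def)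
qed

text \<open>Top-dimensional simplexes suffice because the apexes of any chain occur among those of a
  chain of length \<open>d + 1\<close>; the added vertexes get coefficient 0.\<close>

lemma UN_point_arrangement:
  assumes "pointed_polytope c P" "aff_dim P = int d"
  shows "(\<Union>\<alpha>\<in>simplexes_of_dim (int d) (pointed_triangulation c P). point_arrangement \<alpha> (Suc m))
    = chain_sums c P m" (is "?L = ?R")
proof (intro equalityI subsetI)
  fix y assume "y \<in> ?L"
  then obtain Gs where "apex_chain c P Gs"
    "y \<in> point_arrangement (convex hull (apex c ` set Gs)) (Suc m)"
    by (auto simp: simplexes_pointed_triangulation[OF assms(1)])
  then show "y \<in> ?R"
    by (auto simp: point_arrangement_eq_sum_mset vertices_chain_simplex[OF assms(1)]
        multisets_of_size_def intro: chain_sumsI)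
next
  fix y assume "y \<in> ?R"
  then obtain M Gs where M: "y = sum_mset M" "size M = m" "apex_chain c P Gs"
    "set_mset M \<subseteq> apex c ` set Gs"
    by (auto simp: chain_sums_def)
  obtain Hs where Hs: "apex_chain c P Hs" "length Hs = Suc d" "apex c ` set Gs \<subseteq> apex c ` set Hs"
    using apex_chain_extend_full[OF assms M(3)] by blast
  then have "y \<in> point_arrangement (convex hull (apex c ` set Hs)) (Suc m)"
    using M(1,2,4)
    by (auto simp: point_arrangement_eq_sum_mset vertices_chain_simplex[OF assms(1)]
        multisets_of_size_def)
  then show "y \<in> ?L"
    using Hs by (auto simp: simplexes_pointed_triangulation[OF assms(1)])
qed

section \<open>The arrangement on the boundary\<close>

definition boundary_arrangement :: "'a::euclidean_space \<Rightarrow> 'a set \<Rightarrow> nat \<Rightarrow> 'a set" where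
  "boundary_arrangement c P n =
     (\<Union>\<alpha>\<in>{\<alpha> \<in> simplexes_of_dim (aff_dim P - 1) (pointed_triangulation c P). \<alpha> \<subseteq> boundary P}.
        point_arrangement \<alpha> n)"

text \<open>The top-dimensional simplexes of a facet have codimension 1 in \<open>P\<close>, belong
  to its triangulation because chains of a face are chains of \<open>P\<close>, and lie in the
  boundary.\<close>

lemma facet_chain_sums_subset_boundary_arrangement:
  assumes "pointed_polytope c P" "F facet_of P"
  shows "chain_sums c F m \<subseteq> boundary_arrangement c P (Suc m)"
proof -
  note F = pointed_polytope_face[OF assms(1) facet_nonempty_face[OF assms(2)]]
  have face: "F face_of P" "F \<subseteq> boundary P"
    using assms polytope_boundary(2) by (auto simp: facet_of_def pointed_polytope_def)
  define k where "k = nat (aff_dim F)"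
  have k: "aff_dim F = int k" "aff_dim P - 1 = int k"
    using assms(2) aff_dim_negative_iff[of F] by (auto simp: k_def facet_of_def not_less[symmetric])
  have "\<alpha> \<in> {\<alpha> \<in> simplexes_of_dim (int k) (pointed_triangulation c P). \<alpha> \<subseteq> boundary P}"
    if "\<alpha> \<in> simplexes_of_dim (int k) (pointed_triangulation c F)" for \<alpha>
  proof -
    obtain Gs where Gs: "\<alpha> = convex hull (apex c ` set Gs)" "apex_chain c F Gs" "length Gs = Suc k"
      using \<open>\<alpha> \<in> _\<close> by (auto simp: simplexes_pointed_triangulation[OF F])
    have "apex c ` set Gs \<subseteq> F"
      using apex_chain_apexes_subset[OF F Gs(2)] vertices_subset[of F] by blast
    then have "\<alpha> \<subseteq> F"
      unfolding Gs(1) by (intro hull_minimal pointed_polytope_convex[OF F])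
    then show ?thesis
      using Gs apex_chain_face[OF face(1) Gs(2)] face(2)
      by (auto simp: simplexes_pointed_triangulation[OF assms(1)])
  qed
  then show ?thesis
    unfolding UN_point_arrangement[OF F k(1), symmetric] boundary_arrangement_def k(2) by blast
qed

lemma boundary_arrangement_subset:
  assumes "pointed_polytope c P" "y \<in> boundary_arrangement c P (Suc m)"
  shows "y \<in> chain_sums c P m" "m > 0 \<Longrightarrow> y /\<^sub>R real m \<in> boundary P"
proof -
  obtain \<alpha> where \<alpha>: "\<alpha> \<in> simplexes_of_dim (aff_dim P - 1) (pointed_triangulation c P)"
    "\<alpha> \<subseteq> boundary P" "y \<in> point_arrangement \<alpha> (Suc m)"
    using assms(2) by (auto simp: boundary_arrangement_def)
  \<comment> \<open>\<open>simplexes_of_dim\<close> is empty in negative dimension, so the existence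
    of such a simplex makes the conversion by \<open>nat\<close> harmless.\<close>
  moreover have "aff_dim P - 1 = int (nat (aff_dim P - 1))"
    using \<alpha>(1) by (simp add: simplexes_of_dim_def)
  ultimately obtain Gs where Gs: "apex_chain c P Gs" "\<alpha> = convex hull (apex c ` set Gs)"
    using simplexes_pointed_triangulation[OF assms(1), of "nat (aff_dim P - 1)"] by auto
  obtain M where M: "y = sum_mset M" "set_mset M \<subseteq> apex c ` set Gs" "size M = m"
    using \<alpha>(3) Gs
    by (auto simp: point_arrangement_eq_sum_mset vertices_chain_simplex[OF assms(1)]
        multisets_of_size_def)
  show "y \<in> chain_sums c P m"
    using M(1) chain_sumsI[OF Gs(1) M(2,3)] by simp
  show "y /\<^sub>R real m \<in> boundary P" if "m > 0"
  proof -
    have "set_mset M \<subseteq> \<alpha>"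
      using M(2) hull_subset[of "apex c ` set Gs" convex] Gs(2) by blast
    moreover have "convex \<alpha>" "M \<noteq> {#}"
      using Gs(2) M(3) that by auto
    ultimately show ?thesis
      using sum_mset_average_convex[of \<alpha> M] \<alpha>(2) M by auto
  qed
qed

text \<open>For \<open>m > 0\<close> the removed sums are exactly those whose average lies in some
  facet. For \<open>m = 0\<close> the only sum is 0, and any facet, which exists in positive
  dimension, removes it.\<close>

lemma chain_sums_minus_boundary_arrangement:
  assumes "pointed_polytope c P"
  shows "m > 0 \<Longrightarrow>
      chain_sums c P m - boundary_arrangement c P (Suc m) = interior_chain_sums c P m"
    and "aff_dim P > 0 \<Longrightarrow> chain_sums c P 0 - boundary_arrangement c P 1 = {}"
proof -
  have P: "polytope P"
    using assms by (simp add: pointed_polytope_def)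
  show "chain_sums c P m - boundary_arrangement c P (Suc m) = interior_chain_sums c P m" if "m > 0"
  proof -
    have "y \<in> boundary_arrangement c P (Suc m) \<longleftrightarrow> y /\<^sub>R real m \<in> boundary P"
      if y: "y \<in> chain_sums c P m" for y
    proof
      assume "y /\<^sub>R real m \<in> boundary P"
      then obtain F where F: "F facet_of P" "y /\<^sub>R real m \<in> F"
        by (auto simp: polytope_boundary(2)[OF P])
      then have "y \<in> chain_sums c F m"
        using y chain_sums_face[OF assms facet_nonempty_face[OF F(1)] \<open>m > 0\<close>] by simp
      then show "y \<in> boundary_arrangement c P (Suc m)"
        using facet_chain_sums_subset_boundary_arrangement[OF assms F(1)] by blast
    qed (rule boundary_arrangement_subset(2)[OF assms _ \<open>m > 0\<close>])
    then show ?thesis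
      using chain_sums_average[OF assms that]
      by (auto simp: interior_chain_sums_def polytope_boundary(1)[OF P])
  qed
  show "chain_sums c P 0 - boundary_arrangement c P 1 = {}" if dim: "aff_dim P > 0"
  proof -
    obtain F where "F facet_of P"
      using polytope_facet_exists[OF P dim] by blast
    then show ?thesis
      using facet_chain_sums_subset_boundary_arrangement[OF assms, of F 0] by (simp add: chain_sums_0)
  qed
qed

section \<open>The counting formulas for all arguments\<close>

theorem theorem3p3:
  fixes P :: "'a::euclidean_space set" and c :: 'a and d n :: nat
  assumes "polytope P" and "aff_dim P = int d"
    and "separates_vertices c P"
  shows "polytope_number c P n =
           int (card (\<Union>\<alpha>\<in>simplexes_of_dim (int d) (pointed_triangulation c P).
             point_arrangement \<alpha> n)) \<and>
         interior_polytope_number c P n =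
           int (card ((\<Union>\<alpha>\<in>simplexes_of_dim (int d) (pointed_triangulation c P).
               point_arrangement \<alpha> n) -
             (\<Union>\<alpha>\<in>{\<alpha> \<in> simplexes_of_dim (int d - 1) (pointed_triangulation c P).
                 \<alpha> \<subseteq> boundary P}. point_arrangement \<alpha> n)))"
proof -
  have "P \<noteq> {}"
    using assms(2) by auto
  then have P: "pointed_polytope c P"
    using assms by (simp add: pointed_polytope_def)
  have boundary: "(\<Union>\<alpha>\<in>{\<alpha> \<in> simplexes_of_dim (int d - 1) (pointed_triangulation c P).
      \<alpha> \<subseteq> boundary P}. point_arrangement \<alpha> n) = boundary_arrangement c P n"
    by (simp add: boundary_arrangement_def assms(2))
  show ?thesis
  proof (cases n)
    \<comment> \<open>No coefficients satisfy \<open>sum + 1 = 0\<close>, so every arrangement is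
      empty, and both numbers are 0 by definition.\<close>
    case 0
    then show ?thesis
      using assms \<open>P \<noteq> {}\<close>
      by (simp add: polytope_number.simps[of c P] interior_polytope_number.simps[of c P]
          point_arrangement_def)
  next
    case (Suc m)
    have total: "(\<Union>\<alpha>\<in>simplexes_of_dim (int d) (pointed_triangulation c P). point_arrangement \<alpha> n)
        = chain_sums c P m"
      unfolding Suc by (rule UN_point_arrangement[OF P assms(2)])
    have "interior_polytope_number c P n =
        int (card (chain_sums c P m - boundary_arrangement c P n))"
    proof (cases "m = 0")
      case False
      then show ?thesis
        using polytope_number_eq_card(2)[OF P] chain_sums_minus_boundary_arrangement(1)[OF P]
        by (simp add: Suc)
    next
      case m: True
      show ?thesis
      \<comment> \<open>Here \<open>n = 1\<close> and the full arrangement is the single point 0. In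
        dimension 0 nothing is removed and the interior number is 1; otherwise 0 is removed and the
        interior number is 0.\<close>
      proof (cases "d = 0")
        case True
        then have "boundary_arrangement c P n = {}"
          using assms(2) by (simp add: boundary_arrangement_def simplexes_of_dim_def)
        then show ?thesis
          using assms \<open>P \<noteq> {}\<close> True
          by (simp add: interior_polytope_number.simps[of c P] Suc m chain_sums_0)
      next
        case False
        then have "chain_sums c P m - boundary_arrangement c P n = {}"
          using chain_sums_minus_boundary_arrangement(2)[OF P] assms(2) by (simp add: Suc m)
        then show ?thesis
          using False assms(2)
          by (simp only: card.empty) (simp add: interior_polytope_number.simps[of c P] Suc m)
      qed
    qed
    then show ?thesis
      unfolding total boundary using polytope_number_eq_card(1)[OF P, of m] Suc by simp
  qed
qed

end
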